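(* Let $K\in\mathcal{S}_0$. For all $\phi\in\widetilde{\Phi}\cup\widetilde{\Psi}$ and all $T\in SL(n)$, $$\widetilde{\Omega}_{\phi}^{orlicz}(TK)=\widetilde{\Omega}_{\phi}^{orlicz}(K),\qquad\widetilde{G}_{\phi}^{orlicz}(TK)=\widetilde{G}_{\phi}^{orlicz}(K).$$
   Context: $SL(n)$ denotes here the set of invertible linear maps $T:\mathbb{R}^n\to\mathbb{R}^n$ with $|\det T|=1$. $B_2^n$ is the closed unit Euclidean ball of $\mathbb{R}^n$, $S^{n-1}$ the unit sphere, $\sigma$ the spherical measure on $S^{n-1}$, $|\cdot|$ volume, $\omega_n=|B_2^n|$. A compact set $K$ that contains the closed segment from the origin to each of its points has radial function $\rho_K(u)=\max\{\lambda:\lambda u\in K\}$, $u\in S^{n-1}$; $K$ is a star body (about the origin) if $\rho_K$ is continuous and positive on $S^{n-1}$. $\mathcal{S}_0$ is the set of star bodies and $\mathcal{K}_0\subset\mathcal{S}_0$ the set of convex bodies with the origin in their interiors. For $K\in\mathcal{S}_0$ the polar body is $K^\circ=\{y:\langle x,y\rangle\leq1\ \forall x\in K\}$. $\mathcal{K}_c$ is the set of $K\in\mathcal{K}_0$ with centroid at the origin, $\mathcal{K}_s$ the set of $K\in\mathcal{K}_0$ with $K^\circ\in\mathcal{K}_c$; $\widetilde{\mathcal{K}}=\mathcal{K}_c\cup\mathcal{K}_s$ and $\widetilde{\mathcal{S}}=\{L\in\mathcal{S}_0: L^\circ\in\widetilde{\mathcal{K}}\}$. The volume radius is $\mathrm{vrad}(K)=(|K|/\omega_n)^{1/n}$.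 Throughout $\phi:(0,\infty)\to(0,\infty)$ is continuous. $\widetilde{\Phi}$ is the set of $\phi$ for which $F(t)=\phi(t^{1/n})$ is either constant or strictly convex; $\widetilde{\Psi}$ the set of $\phi$ for which $F(t)=\phi(t^{1/n})$ is either constant or increasing and strictly concave. For $K,L\in\mathcal{S}_0$, $\widetilde{V}_\phi(K,L)=\frac1n\int_{S^{n-1}}\phi\!\left(\frac{\rho_L(u)}{\rho_K(u)}\right)\rho_K(u)^n\,d\sigma(u)$. For $\phi\in\widetilde{\Phi}$, the dual Orlicz $L_\phi$ affine and geominimal surface areas of $K\in\mathcal{S}_0$ are $\widetilde{\Omega}_{\phi}^{orlicz}(K)=\inf_{L\in\widetilde{\mathcal{S}}}\{n\widetilde{V}_\phi(K,\mathrm{vrad}(L^\circ)L)\}$ and $\widetilde{G}_{\phi}^{orlicz}(K)=\inf_{L\in\widetilde{\mathcal{K}}}\{n\widetilde{V}_\phi(K,\mathrm{vrad}(L^\circ)L)\}$. For $\phi\in\widetilde{\Psi}$ they are defined by the same formulas with $\sup$ in place of $\inf$. *)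

theory Defs
  imports "HOL-Analysis.Analysis"
begin

text \<open>
  The spherical (surface area) measure, introduced as usual through polar coordinates:
  the measure of \<open>A \<subseteq> S\<^sup>n\<^sup>-\<^sup>1\<close> is \<open>n\<close> times the volume of the cone
  \<open>{r u | 0 < r \<le> 1, u \<in> A}\<close>.
\<close>
definition sphere_measure :: "'a::euclidean_space measure" where
  "sphere_measure =
     scale_measure (of_nat DIM('a))
       (distr (restrict_space lborel (cball 0 1 - {0})) (restrict_space borel (sphere 0 1))
          (\<lambda>x. x /\<^sub>R norm x))"

lemma space_sphere_measure [simp]: "space sphere_measure = sphere 0 1"
  by (simp add: sphere_measure_def space_scale_measure space_restrict_space)

lemma sets_sphere_measure [simp, measurable_cong]:
  "sets sphere_measure = sets (restrict_space borel (sphere 0 1))"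
  by (simp add: sphere_measure_def)

lemma emeasure_sphere_measure:
  fixes A :: "'a::euclidean_space set"
  assumes "A \<in> sets (restrict_space borel (sphere 0 1))"
  shows "emeasure sphere_measure A =
    of_nat DIM('a) * emeasure lborel {r *\<^sub>R u | r u. 0 < r \<and> r \<le> 1 \<and> u \<in> A}"
proof -
  let ?C = "cball 0 1 - {0} :: 'a set"
  have A: "A \<subseteq> sphere 0 1"
    using sets.sets_into_space[OF assms] by (simp add: space_restrict_space)
  have C: "?C \<in> sets borel" by measurable
  have "(\<lambda>x::'a. x /\<^sub>R norm x) \<in> measurable (restrict_space lborel ?C) borel"
    by (rule measurable_restrict_space1) measurable
  then have m: "(\<lambda>x::'a. x /\<^sub>R norm x) \<in>
      measurable (restrict_space lborel ?C) (restrict_space borel (sphere 0 1))"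
    by (rule measurable_restrict_space2[rotated]) (auto simp: space_restrict_space)
  have cone: "(\<lambda>x::'a. x /\<^sub>R norm x) -` A \<inter> ?C =
      {r *\<^sub>R u | r u. 0 < r \<and> r \<le> 1 \<and> u \<in> A}"
  proof (intro set_eqI iffI)
    fix x assume x: "x \<in> (\<lambda>x::'a. x /\<^sub>R norm x) -` A \<inter> ?C"
    then have "x = norm x *\<^sub>R (x /\<^sub>R norm x)" by simp
    with x show "x \<in> {r *\<^sub>R u | r u. 0 < r \<and> r \<le> 1 \<and> u \<in> A}"
      by (intro CollectI exI[of _ "norm x"] exI[of _ "x /\<^sub>R norm x"]) auto
  next
    fix x assume "x \<in> {r *\<^sub>R u | r u. 0 < r \<and> r \<le> 1 \<and> u \<in> A}"
    then obtain r u where ru: "x = r *\<^sub>R u" "0 < r" "r \<le> 1" "u \<in> A" by blast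
    with A have u: "norm u = 1" by auto
    then have "u \<noteq> 0" by auto
    with ru u show "x \<in> (\<lambda>x::'a. x /\<^sub>R norm x) -` A \<inter> ?C" by auto
  qed
  show ?thesis
    using m assms C
    by (simp add: sphere_measure_def emeasure_distr emeasure_restrict_space
        space_restrict_space flip: cone)
qed

text \<open>For the sets considered below (compact, containing the origin) the supremum is a maximum.\<close>
definition radial :: "'a::euclidean_space set \<Rightarrow> 'a \<Rightarrow> real" where
  "radial K u = Sup {l. l *\<^sub>R u \<in> K}"

definition star_bodies :: "'a::euclidean_space set set" where
  "star_bodies = {K. compact K \<and> K \<noteq> {} \<and> (\<forall>x\<in>K. closed_segment 0 x \<subseteq> K) \<and>
     continuous_on (sphere 0 1) (radial K) \<and> (\<forall>u\<in>sphere 0 1. 0 < radial K u)}"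

definition convex_bodies0 :: "'a::euclidean_space set set" where
  "convex_bodies0 = {K. compact K \<and> convex K \<and> 0 \<in> interior K}"

definition polar_body :: "'a::euclidean_space set \<Rightarrow> 'a set" where
  "polar_body K = {y. \<forall>x\<in>K. x \<bullet> y \<le> 1}"

definition centroid :: "'a::euclidean_space set \<Rightarrow> 'a" where
  "centroid K = (LINT x:K|lborel. x) /\<^sub>R measure lborel K"

definition vrad :: "'a::euclidean_space set \<Rightarrow> real" where
  "vrad K = root DIM('a) (measure lborel K / measure lborel (cball (0::'a) 1))"

definition K_centroid :: "'a::euclidean_space set set" where
  "K_centroid = {K \<in> convex_bodies0. centroid K = 0}"

definition K_santalo :: "'a::euclidean_space set set" where
  "K_santalo = {K \<in> convex_bodies0. polar_body K \<in> K_centroid}"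

definition K_tilde :: "'a::euclidean_space set set" where
  "K_tilde = K_centroid \<union> K_santalo"

definition S_tilde :: "'a::euclidean_space set set" where
  "S_tilde = {L \<in> star_bodies. polar_body L \<in> K_tilde}"

definition strictly_convex_on :: "real set \<Rightarrow> (real \<Rightarrow> real) \<Rightarrow> bool" where
  "strictly_convex_on S f \<longleftrightarrow> convex S \<and>
     (\<forall>x\<in>S. \<forall>y\<in>S. \<forall>u>0. \<forall>v>0. x \<noteq> y \<longrightarrow> u + v = 1 \<longrightarrow>
        f (u * x + v * y) < u * f x + v * f y)"

definition strictly_concave_on :: "real set \<Rightarrow> (real \<Rightarrow> real) \<Rightarrow> bool" where
  "strictly_concave_on S f \<longleftrightarrow> strictly_convex_on S (\<lambda>x. - f x)"

text \<open>
  A function \<open>(0,\<infinity>) \<rightarrow> (0,\<infinity>)\<close> is a total function on the reals whose values outside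
  \<open>(0,\<infinity>)\<close> are irrelevant.
\<close>
definition Phi_tilde :: "nat \<Rightarrow> (real \<Rightarrow> real) set" where
  "Phi_tilde n = {\<phi>. continuous_on {0<..} \<phi> \<and> (\<forall>t>0. 0 < \<phi> t) \<and>
     ((\<lambda>t. \<phi> (root n t)) constant_on {0<..} \<or>
      strictly_convex_on {0<..} (\<lambda>t. \<phi> (root n t)))}"

definition Psi_tilde :: "nat \<Rightarrow> (real \<Rightarrow> real) set" where
  "Psi_tilde n = {\<phi>. continuous_on {0<..} \<phi> \<and> (\<forall>t>0. 0 < \<phi> t) \<and>
     ((\<lambda>t. \<phi> (root n t)) constant_on {0<..} \<or>
      mono_on {0<..} (\<lambda>t. \<phi> (root n t)) \<and>
      strictly_concave_on {0<..} (\<lambda>t. \<phi> (root n t)))}"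

definition dual_mixed_volume ::
  "(real \<Rightarrow> real) \<Rightarrow> 'a::euclidean_space set \<Rightarrow> 'a set \<Rightarrow> real" where
  "dual_mixed_volume \<phi> K L = 1 / DIM('a) *
     (LINT u|sphere_measure. \<phi> (radial L u / radial K u) * radial K u ^ DIM('a))"

text \<open>
  The surface areas take extended real values, since the suprema may be infinite. The infimum
  versions are those for \<open>\<phi>\<close> in \<^const>\<open>Phi_tilde\<close>, the supremum versions those for \<open>\<phi>\<close> in
  \<^const>\<open>Psi_tilde\<close>.
\<close>
definition Omega_orlicz_inf :: "(real \<Rightarrow> real) \<Rightarrow> 'a::euclidean_space set \<Rightarrow> ereal" where
  "Omega_orlicz_inf \<phi> K =
     (INF L\<in>S_tilde. ereal (DIM('a) * dual_mixed_volume \<phi> K ((*\<^sub>R) (vrad (polar_body L)) ` L)))"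

definition G_orlicz_inf :: "(real \<Rightarrow> real) \<Rightarrow> 'a::euclidean_space set \<Rightarrow> ereal" where
  "G_orlicz_inf \<phi> K =
     (INF L\<in>K_tilde. ereal (DIM('a) * dual_mixed_volume \<phi> K ((*\<^sub>R) (vrad (polar_body L)) ` L)))"

definition Omega_orlicz_sup :: "(real \<Rightarrow> real) \<Rightarrow> 'a::euclidean_space set \<Rightarrow> ereal" where
  "Omega_orlicz_sup \<phi> K =
     (SUP L\<in>S_tilde. ereal (DIM('a) * dual_mixed_volume \<phi> K ((*\<^sub>R) (vrad (polar_body L)) ` L)))"

definition G_orlicz_sup :: "(real \<Rightarrow> real) \<Rightarrow> 'a::euclidean_space set \<Rightarrow> ereal" where
  "G_orlicz_sup \<phi> K =
     (SUP L\<in>K_tilde. ereal (DIM('a) * dual_mixed_volume \<phi> K ((*\<^sub>R) (vrad (polar_body L)) ` L)))"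

definition SL :: "(real^'n \<Rightarrow> real^'n) set" where
  "SL = {T. linear T \<and> bij T \<and> \<bar>det (matrix T)\<bar> = 1}"

end

theory Submission
  imports Defs
begin

text \<open>
  Extend radial functions to \<open>\<rho>\<^sub>K(x) = sup {l. l x \<in> K}\<close> for \<open>x \<noteq> 0\<close>; they are homogeneous of
  degree \<open>-1\<close> and satisfy \<open>\<rho>\<^sub>T\<^sub>K(T x) = \<rho>\<^sub>K(x)\<close>. The integral over the sphere defining the dual mixed
  volume equals \<open>n \<integral> \<phi>(\<rho>\<^sub>L/\<rho>\<^sub>K) (|x| \<rho>\<^sub>K)\<^sup>n dx\<close> over the unit ball. Writing the power as
  \<open>\<integral> n t\<^sup>n\<^sup>-\<^sup>1 dt\<close> over \<open>0 < t \<le> |x| \<rho>\<^sub>K\<close>, exchanging the integrals and substituting \<open>x = y/t\<close>, the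
  norm cancels and what remains is \<open>n\<^sup>2 \<integral> \<phi>(\<rho>\<^sub>L/\<rho>\<^sub>K) max(0, ln \<rho>\<^sub>K) dy\<close> over the whole space,
  which is visibly invariant under volume-preserving linear maps. Since
  \<open>(TL)\<degree> = T\<^sup>-\<^sup>t L\<degree>\<close>, the map \<open>L \<mapsto> TL\<close> permutes both classes of competitors and preserves the
  volume radius of the polar body.
\<close>

subsection \<open>Linear maps and Lebesgue measure\<close>

text \<open>
  The library proves this only over a well-ordered index type, because it computes the
  determinant of a shear by triangularity. Row operations need no order.
\<close>
lemma measure_linear_image_vec:
  fixes f :: "real^'n \<Rightarrow> real^'n"
  assumes "linear f" and "S \<in> lmeasurable"
  shows "f ` S \<in> lmeasurable" and "measure lebesgue (f ` S) = \<bar>det (matrix f)\<bar> * measure lebesgue S"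
proof -
  define P where "P f \<longleftrightarrow> (\<forall>S\<in>lmeasurable. f ` S \<in> lmeasurable \<and>
    measure lebesgue (f ` S) = \<bar>det (matrix f)\<bar> * measure lebesgue S)" for f :: "real^'n \<Rightarrow> real^'n"
  \<comment> \<open>For maps whose determinant has modulus one it suffices that volumes of boxes are
    preserved; this serves the coordinate swaps and the shears.\<close>
  have boxes: "P f" if "linear f" "\<bar>det (matrix f)\<bar> = 1"
    "\<And>a b. cbox a b \<noteq> {} \<Longrightarrow> measure lebesgue (f ` cbox a b) = measure lebesgue (cbox a b)" for f
  proof -
    have "measure lebesgue (f ` cbox a b) = 1 * measure lebesgue (cbox a b)" for a b
      using that(3)[of a b] by (cases "cbox a b = {}") auto
    note measure_linear_sufficient[OF that(1) _ this]
    then have "f ` S \<in> lmeasurable \<and> measure lebesgue (f ` S) = measure lebesgue S"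
      if "S \<in> lmeasurable" for S by (metis that mult_1)
    then show ?thesis unfolding P_def that(2) by simp
  qed
  have "P f" using \<open>linear f\<close>
  proof (rule induct_linear_elementary)
    fix f g :: "real^'n \<Rightarrow> real^'n"
    assume "linear f" "linear g" "P f" "P g"
    then show "P (f \<circ> g)"
      unfolding P_def image_comp[symmetric]
      by (auto simp: matrix_compose det_mul abs_mult mult.assoc)
  next
    fix f :: "real^'n \<Rightarrow> real^'n" and i
    assume f: "linear f" "\<And>x. f x $ i = 0"
    \<comment> \<open>The range misses a basis vector, so \<open>f\<close> is singular: its
      determinant is zero and its images are null sets.\<close>
    then have "axis i 1 \<notin> range f" by (metis axis_nth rangeE zero_neq_one)
    then have "\<not> inj f" using linear_injective_imp_surjective[OF f(1)] by blast
    moreover from this have "negligible (f ` S)" for S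
      using negligible_linear_singular_image[OF f(1)] by blast
    ultimately show "P f"
      using det_nz_iff_inj[OF f(1)]
      by (simp add: P_def negligible_iff_measure)
  next
    fix c :: "'n \<Rightarrow> real"
    have "matrix (\<lambda>x. \<chi> i. c i * x $ i) = (\<chi> i j. if i = j then c i else 0)"
      by (simp add: matrix_def axis_def vec_eq_iff)
    then have "det (matrix (\<lambda>x::real^'n. \<chi> i. c i * x $ i)) = prod c UNIV"
      by (simp add: det_diagonal)
    then show "P (\<lambda>x. \<chi> i. c i * x $ i)"
      by (simp add: P_def measurable_stretch measure_stretch)
  next
    fix m n :: 'n
    let ?t = "Transposition.transpose m n"
    let ?h = "\<lambda>x::real^'n. \<chi> i. x $ ?t i"
    assume "m \<noteq> n"
    show "P ?h"
    proof (rule boxes)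
      show "linear ?h" by (rule linearI) (simp_all add: vec_eq_iff)
      have "matrix ?h = (\<chi> i. mat 1 $ ?t i)"
        by (auto simp: matrix_def mat_def axis_def vec_eq_iff)
      then show "\<bar>det (matrix ?h)\<bar> = 1"
        by (simp add: det_permute_rows[OF permutes_swap_id] sign_def)
      fix a b :: "real^'n" assume ne: "cbox a b \<noteq> {}"
      have inv: "?h (?h x) = x" for x by (simp add: vec_eq_iff)
      have mem: "?h x \<in> cbox (?h a) (?h b) \<longleftrightarrow> x \<in> cbox a b" for x
        by (simp add: mem_box_cart) (metis transpose_involutory)
      have img: "?h ` cbox a b = cbox (?h a) (?h b)"
      proof (intro equalityI subsetI)
        fix y assume "y \<in> cbox (?h a) (?h b)"
        then have "?h y \<in> cbox a b" using mem[of "?h y"] unfolding inv by blast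
        then have "?h (?h y) \<in> ?h ` cbox a b" by (rule imageI)
        then show "y \<in> ?h ` cbox a b" unfolding inv .
      qed (use mem in blast)
      moreover have "(\<Prod>i\<in>UNIV. ?h b $ i - ?h a $ i) = (\<Prod>i\<in>UNIV. b $ i - a $ i)"
        using prod.reindex_bij_betw[of ?t UNIV UNIV "\<lambda>i. b $ i - a $ i"] by (simp add: bij_transpose)
      moreover have "cbox (?h a) (?h b) \<noteq> {}" using ne img by blast
      ultimately show "measure lebesgue (?h ` cbox a b) = measure lebesgue (cbox a b)"
        using ne by (simp add: content_cbox_cart)
    qed
  next
    fix m n :: 'n
    let ?h = "\<lambda>x::real^'n. \<chi> i. if i = m then x $ m + x $ n else x $ i"
    assume mn: "m \<noteq> n"
    show "P ?h"
    proof (rule boxes)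
      show lin: "linear ?h" by (rule linearI) (auto simp: vec_eq_iff algebra_simps)
      have "matrix ?h = (\<chi> k. if k = m then row m (mat 1) + 1 *s row n (mat 1) else row k (mat 1))"
        by (auto simp: matrix_def mat_def axis_def row_def vec_eq_iff)
      then show "\<bar>det (matrix ?h)\<bar> = 1" by (simp add: det_row_operation[OF mn])
      fix a b :: "real^'n" assume ne: "cbox a b \<noteq> {}"
      \<comment> \<open>The shear formula for boxes wants a nonnegative lower end in coordinate
        \<open>n\<close>. Translating by \<open>v\<close> achieves this without changing
        volumes.\<close>
      define v :: "real^'n" where "v = axis n \<bar>a $ n\<bar>"
      have tr: "cbox (v + a) (v + b) = (+) v ` cbox a b"
        using cbox_translation[of v a b] by simp
      have "?h ` cbox (v + a) (v + b) = (+) (?h v) ` (?h ` cbox a b)"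
        unfolding tr image_image using linear_add[OF lin, of v] by (intro image_cong) auto
      then have "measure lebesgue (?h ` cbox a b) = measure lebesgue (?h ` cbox (v + a) (v + b))"
        by (simp only: measure_translation)
      also have "\<dots> = measure lebesgue (cbox (v + a) (v + b))"
      proof (rule measure_shear_interval[OF mn])
        show "cbox (v + a) (v + b) \<noteq> {}" using ne unfolding tr by simp
        show "0 \<le> (v + a) $ n" by (simp add: v_def)
      qed
      also have "\<dots> = measure lebesgue (cbox a b)"
        unfolding tr by (rule measure_translation)
      finally show "measure lebesgue (?h ` cbox a b) = measure lebesgue (cbox a b)" .
    qed
  qed
  then show "f ` S \<in> lmeasurable" "measure lebesgue (f ` S) = \<bar>det (matrix f)\<bar> * measure lebesgue S"
    using assms by (auto simp: P_def)
qed

section \<open>Scaling of integrals and the radial substitution\<close>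

lemma nn_integral_lborel_scaleR:
  fixes f :: "'a::euclidean_space \<Rightarrow> ennreal"
  assumes [measurable]: "f \<in> borel_measurable borel" and "c > 0"
  shows "(\<integral>\<^sup>+x. f x \<partial>lborel) = ennreal (c ^ DIM('a)) * (\<integral>\<^sup>+x. f (c *\<^sub>R x) \<partial>lborel)"
proof -
  have "(\<integral>\<^sup>+x. f x \<partial>lborel) =
      (\<integral>\<^sup>+x. f x \<partial>density (distr lborel borel (\<lambda>x::'a. 0 + c *\<^sub>R x)) (\<lambda>_. \<bar>c\<bar> ^ DIM('a)))"
    using \<open>c > 0\<close> by (subst lborel_affine[of c 0]) auto
  also have "\<dots> = ennreal (c ^ DIM('a)) * (\<integral>\<^sup>+x. f (c *\<^sub>R x) \<partial>lborel)"
    using \<open>c > 0\<close> by (simp add: nn_integral_density nn_integral_distr nn_integral_cmult)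
  finally show ?thesis .
qed

text \<open>Both sides arise from an integral over pairs of a point and a level \<open>t\<close>.
  Under \<open>x = y / t\<close> the degree 0 quantities \<open>h\<close> and
  \<open>norm x * \<rho> x\<close> do not move, the condition \<open>norm x \<le> 1\<close> becomes
  \<open>norm y \<le> t\<close>, and the Jacobian turns \<open>n * t ^ (n - 1)\<close> into
  \<open>n / t\<close>. Integrating \<open>n / t\<close> from \<open>norm y\<close> to
  \<open>norm y * \<rho> y\<close> gives a logarithm in which the norm cancels.\<close>

lemma nn_integral_radial_power_eq_ln:
  fixes h :: "'a::euclidean_space \<Rightarrow> ennreal" and \<rho> :: "'a \<Rightarrow> real"
  defines "n \<equiv> DIM('a)"
  assumes [measurable]: "h \<in> borel_measurable borel" "\<rho> \<in> borel_measurable borel"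
    and h: "\<And>c x. c > 0 \<Longrightarrow> h (c *\<^sub>R x) = h x"
    and \<rho>: "\<And>c x. c > 0 \<Longrightarrow> \<rho> (c *\<^sub>R x) = \<rho> x / c"
    and pos: "\<And>x. x \<noteq> 0 \<Longrightarrow> \<rho> x > 0"
  shows "(\<integral>\<^sup>+x\<in>cball 0 1 - {0}. h x * ennreal ((norm x * \<rho> x) ^ n) \<partial>lborel) =
    (\<integral>\<^sup>+x\<in>-{0}. h x * ennreal (n * max 0 (ln (\<rho> x))) \<partial>lborel)"
proof -
  have n: "n > 0" by (simp add: n_def)
  \<comment> \<open>The interval is open at 0 so that \<open>w x 0 = 0\<close> also in dimension
    one, where \<open>n * 0 ^ (n - 1)\<close> is 1; the substitution is only possible for
    \<open>t > 0\<close>.\<close>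
  define w where "w x t = h x * indicator (cball 0 1 - {0}) x *
      (ennreal (n * t ^ (n - 1)) * indicator {0<..norm x * \<rho> x} t)" for x :: 'a and t :: real
  define w' where "w' x t = h x * indicator (- {0}) x *
      (ennreal (n / t) * indicator {norm x..norm x * \<rho> x} t)" for x :: 'a and t :: real
  \<comment> \<open>With conditionals in place of indicators of intervals that depend on
    \<open>x\<close>, joint measurability can be read off from the conditions.\<close>
  have [measurable]: "(\<lambda>(x,t). w x t) \<in> borel_measurable (borel \<Otimes>\<^sub>M borel)"
  proof -
    have "(\<lambda>(x,t). w x t) = (\<lambda>(x,t::real). h x * (if norm x \<le> 1 \<and> x \<noteq> 0 then 1 else 0) *
      (ennreal (n * t ^ (n - 1)) * (if 0 < t \<and> t \<le> norm x * \<rho> x then 1 else 0)))"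
      by (auto simp: w_def fun_eq_iff)
    also have "\<dots> \<in> borel_measurable (borel \<Otimes>\<^sub>M borel)" by measurable
    finally show ?thesis .
  qed
  have [measurable]: "(\<lambda>(x,t). w' x t) \<in> borel_measurable (borel \<Otimes>\<^sub>M borel)"
  proof -
    have "(\<lambda>(x,t). w' x t) = (\<lambda>(x,t::real). h x * (if x \<noteq> 0 then 1 else 0) *
      (ennreal (n / t) * (if norm x \<le> t \<and> t \<le> norm x * \<rho> x then 1 else 0)))"
      by (auto simp: w'_def fun_eq_iff)
    also have "\<dots> \<in> borel_measurable (borel \<Otimes>\<^sub>M borel)" by measurable
    finally show ?thesis .
  qed
  have w: "(\<integral>\<^sup>+t. w x t \<partial>lborel) = h x * ennreal ((norm x * \<rho> x) ^ n) * indicator (cball 0 1 - {0}) x" for x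
  proof (cases "x = 0")
    case False
    have "(\<integral>\<^sup>+t. ennreal (n * t ^ (n - 1)) * indicator {0<..norm x * \<rho> x} t \<partial>lborel) =
        (\<integral>\<^sup>+t. ennreal (n * t ^ (n - 1)) * indicator {0..norm x * \<rho> x} t \<partial>lborel)"
      by (rule nn_integral_cong_AE, rule eventually_mono[OF AE_lborel_singleton[of 0]])
        (auto simp: indicator_def)
    also have "\<dots> = ennreal ((norm x * \<rho> x) ^ n - 0 ^ n)"
      using pos[OF False]
      by (intro nn_integral_FTC_Icc) (auto intro!: derivative_eq_intros)
    finally show ?thesis
      using n unfolding w_def by (subst nn_integral_cmult) (auto simp: mult_ac zero_power)
  qed (simp add: w_def)
  have w': "(\<integral>\<^sup>+t. w' x t \<partial>lborel) = h x * ennreal (n * max 0 (ln (\<rho> x))) * indicator (- {0}) x" for x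
  proof (cases "x = 0")
    case False
    have "(\<integral>\<^sup>+t. ennreal (n / t) * indicator {norm x..norm x * \<rho> x} t \<partial>lborel) =
        ennreal (n * max 0 (ln (\<rho> x)))"
    proof (cases "\<rho> x \<ge> 1")
      case True
      have "norm x \<le> norm x * \<rho> x" using True by (simp add: mult_le_cancel_left1)
      then have "(\<integral>\<^sup>+t. ennreal (n / t) * indicator {norm x..norm x * \<rho> x} t \<partial>lborel) =
          ennreal (n * ln (norm x * \<rho> x) - n * ln (norm x))"
      proof (intro nn_integral_FTC_Icc[where F = "\<lambda>t. n * ln t"])
        fix t assume "t \<in> {norm x..norm x * \<rho> x}"
        with False have "t > 0" by (auto intro: less_le_trans[of 0 "norm x"])
        then show "((\<lambda>t. n * ln t) has_real_derivative n / t) (at t)" "0 \<le> n / t"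
          by (auto intro!: derivative_eq_intros)
      qed auto
      then show ?thesis using True False
        by (simp add: ln_mult algebra_simps)
    next
      \<comment> \<open>For \<open>\<rho> x < 1\<close> the interval of levels is empty; this is the
        source of the truncation by \<open>max 0\<close>.\<close>
      case F: False
      then have "norm x * \<rho> x < norm x" using False by (simp add: mult_less_cancel_left1)
      then show ?thesis using F pos[OF False] by (simp add: max_def)
    qed
    then show ?thesis
      unfolding w'_def by (subst nn_integral_cmult) (auto simp: mult_ac)
  qed (simp add: w'_def)
  have scale: "(\<integral>\<^sup>+x. w x t \<partial>lborel) = (\<integral>\<^sup>+x. w' x t \<partial>lborel)" for t
  proof (cases "t > 0")
    case True
    have "(\<integral>\<^sup>+x. w x t \<partial>lborel) =
        ennreal ((1 / t) ^ n) * (\<integral>\<^sup>+x. w ((1 / t) *\<^sub>R x) t \<partial>lborel)"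
      unfolding n_def using True by (intro nn_integral_lborel_scaleR) auto
    also have "\<dots> = (\<integral>\<^sup>+x. ennreal ((1 / t) ^ n) * w ((1 / t) *\<^sub>R x) t \<partial>lborel)"
      by (subst nn_integral_cmult) auto
    also have "\<dots> = (\<integral>\<^sup>+x. w' x t \<partial>lborel)"
    proof (intro nn_integral_cong)
      fix x :: 'a
      have c: "ennreal ((1 / t) ^ n) * ennreal (n * t ^ (n - 1)) = ennreal (n / t)"
      proof -
        have "(1 / t) ^ n * (n * t ^ (n - 1)) = n / t"
          using True n by (cases n) (auto simp: field_simps)
        then show ?thesis using True by (metis ennreal_mult' less_imp_le zero_le_divide_1_iff zero_le_power)
      qed
      have 1: "indicator (cball 0 1 - {0}) ((1 / t) *\<^sub>R x) = (if x \<noteq> 0 \<and> norm x \<le> t then 1 else 0 :: ennreal)"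
        using True by (auto simp: indicator_def)
      have 2: "norm ((1 / t) *\<^sub>R x) * \<rho> ((1 / t) *\<^sub>R x) = norm x * \<rho> x"
        using True \<rho>[of "1/t" x] by simp
      have 3: "h ((1 / t) *\<^sub>R x) = h x" using h[of "1/t" x] True by simp
      show "ennreal ((1 / t) ^ n) * w ((1 / t) *\<^sub>R x) t = w' x t"
        unfolding w_def w'_def 1 2 3 c[symmetric] using True
        by (auto simp: indicator_def mult_ac)
    qed
    finally show ?thesis .
  next
    case False
    have "w x t = 0" for x using False by (simp add: w_def)
    moreover have "w' x t = 0" for x
    proof (cases "x = 0")
      case x: False
      with False have "\<not> norm x \<le> t" by (meson less_le_trans zero_less_norm_iff)
      then show ?thesis by (simp add: w'_def)
    qed (simp add: w'_def)
    ultimately show ?thesis by simp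
  qed
  have "(\<integral>\<^sup>+x. \<integral>\<^sup>+t. w x t \<partial>lborel \<partial>lborel) = (\<integral>\<^sup>+t. \<integral>\<^sup>+x. w x t \<partial>lborel \<partial>lborel)"
    by (rule lborel_pair.Fubini') simp
  also have "\<dots> = (\<integral>\<^sup>+x. \<integral>\<^sup>+t. w' x t \<partial>lborel \<partial>lborel)"
    unfolding scale by (rule lborel_pair.Fubini'[symmetric]) simp
  finally show ?thesis unfolding w w' .
qed

subsection \<open>Radial functions\<close>

lemma compact_linear_image:
  fixes f :: "'a::euclidean_space \<Rightarrow> 'b::real_normed_vector"
  assumes "linear f" "compact S"
  shows "compact (f ` S)"
  using assms by (simp add: compact_continuous_image linear_continuous_on linear_conv_bounded_linear)

text \<open>A common weakening of \<open>star_bodies\<close> and \<open>convex_bodies0\<close>, so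
  that competitors from both classes are treated together. It makes the radial function positive,
  homogeneous and Borel away from the origin. Taking \<open>x = 0\<close> in the last clause puts
  the origin into \<open>K\<close>.\<close>

definition starlike_body :: "'a::euclidean_space set \<Rightarrow> bool" where
  "starlike_body K \<longleftrightarrow> compact K \<and> (\<forall>x\<in>K. closed_segment 0 x \<subseteq> K) \<and> (\<forall>x. \<exists>l>0. l *\<^sub>R x \<in> K)"

text \<open>For a nonempty slice, the two facts make the supremum in \<open>radial\<close> a
  maximum.\<close>

lemma compact_radial_slice:
  fixes K :: "'a::euclidean_space set"
  assumes "compact K" "x \<noteq> 0"
  shows "closed {l. l *\<^sub>R x \<in> K}" and "bdd_above {l. l *\<^sub>R x \<in> K}"
proof -
  have "closed ((\<lambda>l. l *\<^sub>R x) -` K)"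
    using assms by (intro continuous_closed_vimage) (auto simp: compact_imp_closed)
  then show "closed {l. l *\<^sub>R x \<in> K}" by (simp add: vimage_def)
  obtain B where B: "\<And>y. y \<in> K \<Longrightarrow> norm y \<le> B"
    using assms compact_imp_bounded bounded_iff by metis
  show "bdd_above {l. l *\<^sub>R x \<in> K}"
  proof (rule bdd_aboveI)
    fix l assume "l \<in> {l. l *\<^sub>R x \<in> K}"
    then have "\<bar>l\<bar> * norm x \<le> B" using B[of "l *\<^sub>R x"] by simp
    then have "\<bar>l\<bar> \<le> B / norm x" using assms by (simp add: field_simps)
    then show "l \<le> B / norm x" by simp
  qed
qed

lemma starlike_body_scaleR:
  assumes "starlike_body K" "x \<in> K" "0 \<le> c" "c \<le> 1"
  shows "c *\<^sub>R x \<in> K"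
proof -
  have "c *\<^sub>R x \<in> closed_segment 0 x" using assms by (auto simp: in_segment)
  then show ?thesis using assms unfolding starlike_body_def by blast
qed

text \<open>Trades the supremum for membership in \<open>K\<close>: it is attained, and
  star-shapedness puts all smaller positive multiples into \<open>K\<close>.\<close>

lemma le_radial_iff:
  fixes K :: "'a::euclidean_space set"
  assumes K: "starlike_body K" and "x \<noteq> 0" "l > 0"
  shows "l \<le> radial K x \<longleftrightarrow> l *\<^sub>R x \<in> K"
proof
  have c: "compact K" using K by (simp add: starlike_body_def)
  note slice = compact_radial_slice[OF c \<open>x \<noteq> 0\<close>]
  { assume "l *\<^sub>R x \<in> K"
    then show "l \<le> radial K x"
      unfolding radial_def by (intro cSup_upper slice) simp }
  assume le: "l \<le> radial K x"
  have "\<exists>l. l *\<^sub>R x \<in> K" using K unfolding starlike_body_def by blast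
  then have "radial K x \<in> {l. l *\<^sub>R x \<in> K}"
    unfolding radial_def by (intro closed_contains_Sup slice) auto
  then have "(l / radial K x) *\<^sub>R (radial K x *\<^sub>R x) \<in> K"
    using le \<open>l > 0\<close> by (intro starlike_body_scaleR[OF K, of _ "l / radial K x"]) auto
  then show "l *\<^sub>R x \<in> K" using le \<open>l > 0\<close> by simp
qed

lemma radial_pos:
  assumes K: "starlike_body K" and "x \<noteq> 0"
  shows "radial K x > 0"
proof -
  obtain l where "l > 0" "l *\<^sub>R x \<in> K" using K unfolding starlike_body_def by blast
  then show ?thesis using le_radial_iff[OF K \<open>x \<noteq> 0\<close>, of l] by auto
qed

lemma radial_scaleR:
  assumes K: "starlike_body K" and "x \<noteq> 0" "c > 0"
  shows "radial K (c *\<^sub>R x) = radial K x / c"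
proof -
  \<comment> \<open>Two positive reals with the same positive lower bounds are equal.\<close>
  have "l \<le> radial K (c *\<^sub>R x) \<longleftrightarrow> l \<le> radial K x / c" if "l > 0" for l
    using le_radial_iff[OF K, of "c *\<^sub>R x" l] le_radial_iff[OF K, of x "l * c"] that assms
    by (simp add: field_simps)
  moreover have "radial K (c *\<^sub>R x) > 0" "radial K x / c > 0"
    using radial_pos[OF K] assms by auto
  ultimately show ?thesis by (meson order.antisym order_refl)
qed

text \<open>As \<open>l *\<^sub>R f x = f (l *\<^sub>R x)\<close>, injectivity makes the two sets of
  admissible multiples equal.\<close>

lemma radial_linear_image:
  assumes "linear f" "inj f"
  shows "radial (f ` K) (f x) = radial K x"
  using assms unfolding radial_def
  by (simp add: inj_image_mem_iff flip: linear_cmul)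

lemma starlike_body_linear_image:
  fixes f :: "'a::euclidean_space \<Rightarrow> 'a"
  assumes K: "starlike_body K" and f: "linear f" "bij f"
  shows "starlike_body (f ` K)"
  unfolding starlike_body_def
proof (intro conjI ballI allI)
  show "compact (f ` K)"
    using K f by (intro compact_linear_image) (auto simp: starlike_body_def)
  show "closed_segment 0 y \<subseteq> f ` K" if "y \<in> f ` K" for y
    using that K closed_segment_linear_image[OF f(1), of 0]
    by (force simp: starlike_body_def linear_0[OF f(1)])
  fix y
  obtain x where "y = f x" using f by (metis bij_pointE)
  moreover obtain l where "l > 0" "l *\<^sub>R x \<in> K" using K unfolding starlike_body_def by blast
  ultimately show "\<exists>l>0. l *\<^sub>R y \<in> f ` K"
    by (intro exI[of _ l]) (simp flip: linear_cmul[OF f(1)])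
qed

lemma starlike_body_scale_image:
  assumes "starlike_body K" "c > 0"
  shows "starlike_body ((*\<^sub>R) c ` K)"
  using assms
  by (intro starlike_body_linear_image)
    (auto intro!: bijI injI surjI[of _ "(*\<^sub>R) (inverse c)"])

section \<open>Star bodies and convex bodies as starlike bodies\<close>

lemma starlike_body_star_bodies:
  assumes "K \<in> star_bodies"
  shows "starlike_body K"
  unfolding starlike_body_def
proof (intro conjI ballI allI)
  have K: "compact K" "K \<noteq> {}" and seg: "\<And>x. x \<in> K \<Longrightarrow> closed_segment 0 x \<subseteq> K"
    and pos: "\<And>u. norm u = 1 \<Longrightarrow> 0 < radial K u"
    using assms by (auto simp: star_bodies_def)
  show "compact K" by (fact K)
  show "closed_segment 0 x \<subseteq> K" if "x \<in> K" for x using that by (rule seg)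
  fix x :: 'a
  have 0: "0 \<in> K" using K seg by fastforce
  show "\<exists>l>0. l *\<^sub>R x \<in> K"
  proof (cases "x = 0")
    case True
    then show ?thesis using 0 by (auto intro: exI[of _ 1])
  next
    case False
    define u where "u = x /\<^sub>R norm x"
    have u: "norm u = 1" "u \<noteq> 0" using False by (auto simp: u_def)
    \<comment> \<open>A positive supremum forces a positive member; the set is nonempty because the
      origin lies in \<open>K\<close>.\<close>
    have "\<exists>l\<in>{l. l *\<^sub>R u \<in> K}. 0 < l"
      using pos[OF u(1)] compact_radial_slice(2)[OF K(1) u(2)] 0
      unfolding radial_def by (subst (asm) less_cSup_iff) (auto intro: exI[of _ 0])
    then obtain l where "l > 0" "l *\<^sub>R u \<in> K" by blast
    then show ?thesis using False by (intro exI[of _ "l / norm x"]) (auto simp: u_def divide_inverse)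
  qed
qed

lemma starlike_body_convex_bodies0:
  assumes "K \<in> convex_bodies0"
  shows "starlike_body K"
  unfolding starlike_body_def
proof (intro conjI ballI allI)
  have K: "compact K" "convex K" "0 \<in> interior K"
    using assms by (auto simp: convex_bodies0_def)
  show "compact K" by (fact K)
  show "closed_segment 0 x \<subseteq> K" if "x \<in> K" for x
    using K that interior_subset by (intro closed_segment_subset) auto
  fix x :: 'a
  obtain e where e: "e > 0" "ball 0 e \<subseteq> K"
    using K mem_interior by blast
  \<comment> \<open>Adding 1 to the norm keeps the factor positive at \<open>x = 0\<close>
    too.\<close>
  have "e / (norm x + 1) * norm x < e"
    using e by (simp add: pos_divide_less_eq add_nonneg_pos)
  then have "(e / (norm x + 1)) *\<^sub>R x \<in> K"
    using e by (intro subsetD[OF e(2)]) (auto simp: abs_of_pos add_nonneg_pos)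
  moreover have "e / (norm x + 1) > 0" using e by (auto simp: add_nonneg_pos)
  ultimately show "\<exists>l>0. l *\<^sub>R x \<in> K" by blast
qed

text \<open>At the origin the set of multiples is the whole line and its \<open>Sup\<close> is
  unspecified, hence the default value 0. A superlevel set at \<open>a > 0\<close> is then the
  closed preimage of \<open>K\<close> under multiplication by \<open>a\<close>, without the
  origin.\<close>

lemma borel_measurable_radial:
  fixes K :: "'a::euclidean_space set"
  assumes K: "starlike_body K"
  shows "(\<lambda>x. if x = 0 then 0 else radial K x) \<in> borel_measurable borel" (is "?r \<in> _")
  unfolding borel_measurable_iff_ge
proof
  fix a
  have "{x. a \<le> ?r x} \<in> sets borel"
  proof (cases "a > 0")
    case True
    then have "{x. a \<le> ?r x} = ((*\<^sub>R) a -` K) - {0}"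
      using le_radial_iff[OF K] by auto
    moreover have "closed ((*\<^sub>R) a -` K)"
      using K by (intro continuous_closed_vimage) (auto simp: starlike_body_def compact_imp_closed)
    ultimately show ?thesis by auto
  next
    case False
    then have "{x. a \<le> ?r x} = UNIV" using radial_pos[OF K] by (force intro: order_trans[of a 0] less_imp_le)
    then show ?thesis by simp
  qed
  then show "{x \<in> space borel. a \<le> ?r x} \<in> sets borel" by simp
qed

text \<open>Homogeneity moves the integral from the sphere to the punctured ball, where the norm can
  be eliminated. The dimension factor in \<open>sphere_measure\<close> cancels the one in
  \<open>dual_mixed_volume\<close>.\<close>

lemma dual_mixed_volume_eq_nn_integral:
  fixes K L :: "'a::euclidean_space set"
  assumes K: "starlike_body K" and L: "starlike_body L"
    and cont: "continuous_on {0<..} \<phi>" and pos: "\<And>t. t > 0 \<Longrightarrow> 0 < \<phi> t"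
  shows "dual_mixed_volume \<phi> K L =
    enn2real (\<integral>\<^sup>+x\<in>-{0}. ennreal (\<phi> (radial L x / radial K x)) *
      ennreal (DIM('a) * max 0 (ln (radial K x))) \<partial>lborel)"
proof -
  \<comment> \<open>Default values make everything Borel on the whole space: the radial functions
    become 0 at the origin, and \<open>\<psi>\<close> extends \<open>\<phi>\<close> by zero.\<close>
  define rK where "rK x = (if x = 0 then 0 else radial K x)" for x
  define rL where "rL x = (if x = 0 then 0 else radial L x)" for x
  define \<psi> where "\<psi> t = (if t \<in> {0<..} then \<phi> t else 0)" for t
  define h where "h x = ennreal (\<psi> (rL x / rK x))" for x
  define g where "g x = \<psi> (rL x / rK x) * rK x ^ DIM('a)" for x
  have [measurable]: "rK \<in> borel_measurable borel" "rL \<in> borel_measurable borel"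
    unfolding rK_def rL_def using K L by (auto intro: borel_measurable_radial)
  have [measurable]: "\<psi> \<in> borel_measurable borel"
    unfolding \<psi>_def using cont by (intro borel_measurable_continuous_on_if) auto
  have [measurable]: "h \<in> borel_measurable borel" "g \<in> borel_measurable borel"
    unfolding h_def g_def by measurable
  have pos': "\<psi> t \<ge> 0" for t using pos[of t] by (auto simp: \<psi>_def)
  have rK_pos: "rK x > 0" and rL_pos: "rL x > 0" if "x \<noteq> 0" for x
    using that radial_pos[OF K] radial_pos[OF L] by (auto simp: rK_def rL_def)
  have rK_scale: "rK (c *\<^sub>R x) = rK x / c" and rL_scale: "rL (c *\<^sub>R x) = rL x / c" if "c > 0" for c x
    using that radial_scaleR[OF K] radial_scaleR[OF L] by (auto simp: rK_def rL_def)
  have h_scale: "h (c *\<^sub>R x) = h x" if "c > 0" for c x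
    using that by (simp add: h_def rK_scale rL_scale)
  have rK_nonneg: "rK x \<ge> 0" for x using rK_pos[of x] by (cases "x = 0") (auto simp: rK_def)
  have g_nonneg: "g x \<ge> 0" for x
    by (simp add: g_def pos' rK_nonneg)
  have \<psi>_eq: "\<psi> (rL x / rK x) = \<phi> (radial L x / radial K x)" if "x \<noteq> 0" for x
    using that radial_pos[OF K] radial_pos[OF L] by (simp add: \<psi>_def rL_def rK_def)
  let ?C = "cball 0 1 - {0} :: 'a set"
  have "(\<lambda>x::'a. x /\<^sub>R norm x) \<in> measurable (restrict_space lborel ?C) borel"
    by (rule measurable_restrict_space1) measurable
  then have m: "(\<lambda>x::'a. x /\<^sub>R norm x) \<in>
      measurable (restrict_space lborel ?C) (restrict_space borel (sphere 0 1))"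
    by (rule measurable_restrict_space2[rotated]) (auto simp: space_restrict_space)
  have g_sphere: "g \<in> borel_measurable (restrict_space borel (sphere 0 1))"
    by (rule measurable_restrict_space1) measurable
  have C: "?C \<in> sets borel" by measurable
  have "(LINT u|sphere_measure. \<phi> (radial L u / radial K u) * radial K u ^ DIM('a)) =
      (LINT u|sphere_measure. g u)"
  proof (rule Bochner_Integration.integral_cong)
    fix u :: 'a assume "u \<in> space sphere_measure"
    then have "u \<noteq> 0" by auto
    then show "\<phi> (radial L u / radial K u) * radial K u ^ DIM('a) = g u"
      unfolding g_def \<psi>_eq[OF \<open>u \<noteq> 0\<close>] by (simp add: rK_def)
  qed simp
  \<comment> \<open>For a nonnegative measurable integrand this covers an infinite integral too:
    both sides are then 0.\<close>
  also have "\<dots> = enn2real (\<integral>\<^sup>+u. ennreal (g u) \<partial>sphere_measure)"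
    using g_sphere g_nonneg by (intro integral_eq_nn_integral) (auto cong: measurable_cong_sets)
  also have "(\<integral>\<^sup>+u. ennreal (g u) \<partial>sphere_measure) =
      of_nat DIM('a) * (\<integral>\<^sup>+x\<in>?C. ennreal (g (x /\<^sub>R norm x)) \<partial>lborel)"
    unfolding sphere_measure_def using g_sphere m C
    by (simp add: nn_integral_scale_measure nn_integral_distr nn_integral_restrict_space)
  also have "(\<integral>\<^sup>+x\<in>?C. ennreal (g (x /\<^sub>R norm x)) \<partial>lborel) =
      (\<integral>\<^sup>+x\<in>?C. h x * ennreal ((norm x * rK x) ^ DIM('a)) \<partial>lborel)"
  proof (rule nn_integral_cong)
    fix x :: 'a
    show "ennreal (g (x /\<^sub>R norm x)) * indicator ?C x =
        h x * ennreal ((norm x * rK x) ^ DIM('a)) * indicator ?C x"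
    proof (cases "x = 0")
      case False
      \<comment> \<open>The quotient has degree 0, while
        \<open>rK (x /\<^sub>R norm x) = norm x * rK x\<close>.\<close>
      then have "g (x /\<^sub>R norm x) = \<psi> (rL x / rK x) * (norm x * rK x) ^ DIM('a)"
        by (simp add: g_def rK_scale rL_scale field_simps)
      then show ?thesis by (simp add: h_def pos' ennreal_mult')
    qed simp
  qed
  also have "\<dots> = (\<integral>\<^sup>+x\<in>-{0}. h x * ennreal (DIM('a) * max 0 (ln (rK x))) \<partial>lborel)"
    by (rule nn_integral_radial_power_eq_ln) (use h_scale rK_scale rK_pos in auto)
  also have "\<dots> = (\<integral>\<^sup>+x\<in>-{0}. ennreal (\<phi> (radial L x / radial K x)) *
      ennreal (DIM('a) * max 0 (ln (radial K x))) \<partial>lborel)"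
  proof (rule nn_integral_cong)
    fix x :: 'a
    show "h x * ennreal (DIM('a) * max 0 (ln (rK x))) * indicator (- {0}) x =
        ennreal (\<phi> (radial L x / radial K x)) *
        ennreal (DIM('a) * max 0 (ln (radial K x))) * indicator (- {0}) x"
    proof (cases "x = 0")
      case False
      show ?thesis unfolding h_def \<psi>_eq[OF False] using False by (simp add: rK_def)
    qed simp
  qed
  finally show ?thesis
    by (simp add: dual_mixed_volume_def enn2real_mult)
qed

subsection \<open>Maps of determinant one\<close>

lemma SL_D:
  assumes "T \<in> SL"
  shows "linear T" "bij T" "inj T" "surj T" "\<bar>det (matrix T)\<bar> = 1"
  using assms by (auto simp: SL_def bij_is_inj bij_is_surj)

lemma SL_inv:
  assumes "T \<in> SL"
  shows "inv T \<in> SL"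
proof -
  note T = SL_D[OF assms]
  have lin: "linear (inv T)" by (rule inj_linear_imp_inv_linear) (use T in auto)
  have "T \<circ> inv T = id" using T by (simp add: surj_iff)
  then have "matrix T ** matrix (inv T) = mat 1"
    using matrix_compose[OF lin T(1)] by (simp add: matrix_id_mat_1)
  then have "det (matrix T) * det (matrix (inv T)) = 1"
    by (metis det_I det_mul)
  then have "\<bar>det (matrix T)\<bar> * \<bar>det (matrix (inv T))\<bar> = 1"
    by (metis abs_mult abs_one)
  then show ?thesis using T lin by (simp add: SL_def bij_imp_bij_inv)
qed

text \<open>\<open>adjoint (inv T)\<close> is the inverse transpose, the map by which polar bodies
  move. Transposition preserves the determinant.\<close>

lemma SL_adjoint:
  fixes T :: "real^'n \<Rightarrow> real^'n"
  assumes "T \<in> SL"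
  shows "adjoint T \<in> SL" and "adjoint (inv T) (adjoint T y) = y"
proof -
  note T = SL_D[OF assms] and T' = SL_D[OF SL_inv[OF assms]]
  have "x \<bullet> adjoint (inv T) (adjoint T y) = x \<bullet> y" for x y
    unfolding adjoint_works[OF T(1)] adjoint_works[OF T'(1)] surj_f_inv_f[OF T(4)] ..
  then have 1: "adjoint (inv T) (adjoint T y) = y" for y
    by (metis vector_eq_ldot)
  then show "adjoint (inv T) (adjoint T y) = y" .
  have "x \<bullet> adjoint T (adjoint (inv T) y) = x \<bullet> y" for x y
    unfolding adjoint_works[OF T(1)] adjoint_works[OF T'(1)] inv_f_f[OF T(3)] ..
  then have 2: "adjoint T (adjoint (inv T) y) = y" for y
    by (metis vector_eq_ldot)
  have "bij (adjoint T)" by (rule o_bij[of "adjoint (inv T)"]) (auto simp: 1 2)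
  then show "adjoint T \<in> SL"
    using SL_D[OF assms] by (simp add: SL_def adjoint_linear matrix_adjoint)
qed

section \<open>Invariance of Lebesgue measure\<close>

lemma measurable_SL:
  fixes T :: "real^'n \<Rightarrow> real^'n"
  assumes "T \<in> SL"
  shows "T \<in> borel_measurable borel"
  using SL_D(1)[OF assms]
  by (intro borel_measurable_continuous_onI linear_continuous_on) (simp add: linear_conv_bounded_linear)

text \<open>Boxes determine Lebesgue measure, and the preimage of a box is its image under
  \<open>inv T\<close>, whose determinant again has modulus one.\<close>

lemma distr_lborel_SL:
  fixes T :: "real^'n \<Rightarrow> real^'n"
  assumes "T \<in> SL"
  shows "distr lborel borel T = lborel"
proof (rule lborel_eqI[symmetric])
  note T = SL_D[OF assms] and T' = SL_D[OF SL_inv[OF assms]]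
  note [measurable] = measurable_SL[OF assms]
  fix l u :: "real^'n" assume le: "\<And>b. b \<in> Basis \<Longrightarrow> l \<bullet> b \<le> u \<bullet> b"
  have vimage: "T -` box l u = inv T ` box l u"
    using T by (simp add: bij_vimage_eq_inv_image)
  have box: "box l u \<in> lmeasurable" by simp
  have borel: "T -` box l u \<in> sets borel"
    using measurable_sets[OF measurable_SL[OF assms], of "box l u"] by simp
  have "emeasure (distr lborel borel T) (box l u) = emeasure lborel (T -` box l u)"
    by (subst emeasure_distr) auto
  \<comment> \<open>The preimage is Borel, so \<open>lborel\<close> and its completion agree on it;
    the volume formula for linear images concerns the completion.\<close>
  also have "\<dots> = emeasure lebesgue (inv T ` box l u)"
    using borel by (simp add: vimage)
  also have "\<dots> = ennreal (measure lebesgue (inv T ` box l u))"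
    by (intro emeasure_eq_measure2 measure_linear_image_vec(1) T' box)
  also have "\<dots> = ennreal (measure lebesgue (box l u))"
    by (simp add: measure_linear_image_vec(2)[OF T'(1) box] T')
  also have "\<dots> = (\<Prod>b\<in>Basis. (u - l) \<bullet> b)"
    using le by (simp add: measure_lborel_box_eq)
  finally show "emeasure (distr lborel borel T) (box l u) = (\<Prod>b\<in>Basis. (u - l) \<bullet> b)" .
qed simp

lemma measure_SL_image:
  fixes T :: "real^'n \<Rightarrow> real^'n"
  assumes T: "T \<in> SL" and [measurable]: "A \<in> sets borel"
  shows "measure lborel (T ` A) = measure lborel A"
proof -
  note [measurable] = measurable_SL[OF SL_inv[OF T]]
  have "T ` A = inv T -` A"
    using SL_D[OF T] by (simp add: bij_vimage_eq_inv_image bij_imp_bij_inv inv_inv_eq)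
  then have "measure lborel (T ` A) = measure (distr lborel borel (inv T)) A"
    by (simp add: measure_distr)
  then show ?thesis by (simp add: distr_lborel_SL SL_inv T)
qed

section \<open>Volume radius, centroid and polar body under linear maps\<close>

lemma vrad_SL_image:
  fixes T :: "real^'n \<Rightarrow> real^'n"
  assumes "T \<in> SL" "A \<in> sets borel"
  shows "vrad (T ` A) = vrad A"
  by (simp add: vrad_def measure_SL_image assms)

lemma centroid_SL_image:
  fixes T :: "real^'n \<Rightarrow> real^'n"
  assumes T: "T \<in> SL" and K: "compact K"
  shows "centroid (T ` K) = T (centroid K)"
proof -
  note lin = SL_D(1)[OF T]
  note [measurable] = measurable_SL[OF T]
  have "compact (T ` K)"
    using K lin by (intro compact_linear_image)
  then have [measurable]: "T ` K \<in> sets borel" "K \<in> sets borel" using K by (auto simp: borel_compact)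
  have "(LINT x:T ` K|lborel. x) = (LINT x|distr lborel borel T. indicator (T ` K) x *\<^sub>R x)"
    by (simp add: distr_lborel_SL[OF T] set_lebesgue_integral_def)
  also have "\<dots> = (LINT x|lborel. indicator (T ` K) (T x) *\<^sub>R T x)"
    by (subst integral_distr) auto
  also have "\<dots> = (LINT x|lborel. T (indicator K x *\<^sub>R x))"
    using SL_D[OF T]
    by (intro Bochner_Integration.integral_cong) (auto simp: indicator_def linear_0 inj_image_mem_iff)
  \<comment> \<open>A bounded linear map passes through the integral of an integrable function; the
    identity is integrable over the compact set \<open>K\<close>.\<close>
  also have "\<dots> = T (LINT x|lborel. indicator K x *\<^sub>R x)"
    using lin borel_integrable_compact[OF K continuous_on_id]
    by (intro integral_bounded_linear) (auto simp: linear_conv_bounded_linear)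
  finally show ?thesis
    using K by (simp add: centroid_def set_lebesgue_integral_def measure_SL_image[OF T] borel_compact linear_cmul[OF lin])
qed

text \<open>Since \<open>T x \<bullet> y = x \<bullet> adjoint T y\<close>, a point lies in the
  polar of the image exactly when \<open>adjoint T\<close> sends it into the polar of
  \<open>K\<close>.\<close>

lemma polar_body_SL_image:
  fixes T :: "real^'n \<Rightarrow> real^'n"
  assumes T: "T \<in> SL"
  shows "polar_body (T ` K) = adjoint (inv T) ` polar_body K"
proof -
  have *: "y \<in> polar_body (T ` K) \<longleftrightarrow> adjoint T y \<in> polar_body K" for y
    by (simp add: polar_body_def adjoint_works[OF SL_D(1)[OF T]])
  have "inv (inv T) = T" using SL_D[OF T] by (simp add: inv_inv_eq)
  then have inv: "adjoint T (adjoint (inv T) z) = z" for z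
    using SL_adjoint(2)[OF SL_inv[OF T], of z] by simp
  show ?thesis
  proof (intro equalityI subsetI)
    fix y assume "y \<in> polar_body (T ` K)"
    then have "adjoint (inv T) (adjoint T y) \<in> adjoint (inv T) ` polar_body K"
      unfolding * by (rule imageI)
    then show "y \<in> adjoint (inv T) ` polar_body K" unfolding SL_adjoint(2)[OF T] .
  next
    fix y assume "y \<in> adjoint (inv T) ` polar_body K"
    then show "y \<in> polar_body (T ` K)" unfolding * by (auto simp: inv)
  qed
qed

lemma closed_polar_body: "closed (polar_body K)"
proof -
  have "polar_body K = (\<Inter>x\<in>K. {y. x \<bullet> y \<le> 1})" by (auto simp: polar_body_def)
  then show ?thesis by (simp add: closed_INT closed_halfspace_le)
qed

text \<open>A ball of radius \<open>e\<close> inside \<open>K\<close> bounds the polar by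
  \<open>1 / e\<close>, and a norm bound \<open>B\<close> on \<open>K\<close> puts the ball of
  radius \<open>1 / B\<close> into the polar.\<close>

lemma polar_body_convex_bodies0:
  fixes K :: "'a::euclidean_space set"
  assumes "K \<in> convex_bodies0"
  shows "polar_body K \<in> convex_bodies0"
proof -
  have K: "compact K" "0 \<in> interior K" using assms by (auto simp: convex_bodies0_def)
  obtain e where e: "e > 0" "cball 0 e \<subseteq> K" using K mem_interior_cball by blast
  have "norm y \<le> 1 / e" if "y \<in> polar_body K" for y
  proof (cases "y = 0")
    case False
    \<comment> \<open>Test \<open>y\<close> against the point of \<open>K\<close> at distance
      \<open>e\<close> in its own direction.\<close>
    have "(e / norm y) *\<^sub>R y \<in> K" using False e by (intro subsetD[OF e(2)]) auto
    then have "((e / norm y) *\<^sub>R y) \<bullet> y \<le> 1" using that by (auto simp: polar_body_def)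
    then have "e * norm y \<le> 1" using False by (simp add: dot_square_norm power2_eq_square)
    then show ?thesis using e by (simp add: field_simps)
  qed (use e in simp)
  then have "bounded (polar_body K)" by (auto simp: bounded_iff)
  moreover have "convex (polar_body K)"
  proof -
    have "polar_body K = (\<Inter>x\<in>K. {y. x \<bullet> y \<le> 1})" by (auto simp: polar_body_def)
    then show ?thesis by (simp add: convex_INT convex_halfspace_le)
  qed
  moreover have "0 \<in> interior (polar_body K)"
  proof -
    obtain B where B: "B > 0" "\<And>x. x \<in> K \<Longrightarrow> norm x \<le> B"
      using K compact_imp_bounded bounded_pos by metis
    have "ball 0 (1 / B) \<subseteq> polar_body K"
    proof
      fix y :: 'a assume y: "y \<in> ball 0 (1 / B)"
      show "y \<in> polar_body K"
        unfolding polar_body_def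
      proof (intro CollectI ballI)
        fix x assume "x \<in> K"
        have "x \<bullet> y \<le> norm x * norm y" by (rule norm_cauchy_schwarz)
        also have "\<dots> \<le> B * (1 / B)" using B \<open>x \<in> K\<close> y by (intro mult_mono) auto
        finally show "x \<bullet> y \<le> 1" using B by simp
      qed
    qed
    then show ?thesis using B by (auto simp: mem_interior intro!: exI[of _ "1 / B"])
  qed
  ultimately show ?thesis
    using closed_polar_body by (auto simp: convex_bodies0_def compact_eq_bounded_closed)
qed

text \<open>Applied to the polar of a competitor, this makes the dilation factor in the surface
  areas positive, so the dilated competitor stays starlike.\<close>

lemma vrad_pos:
  fixes K :: "'a::euclidean_space set"
  assumes "K \<in> convex_bodies0"
  shows "vrad K > 0"
proof -
  have K: "compact K" "0 \<in> interior K" using assms by (auto simp: convex_bodies0_def)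
  obtain e where e: "e > 0" "ball 0 e \<subseteq> K" using K mem_interior by blast
  have "0 < measure lborel (ball 0 e :: 'a set)" using e(1) by (rule content_ball_pos)
  also have "\<dots> \<le> measure lborel K"
    using e(2) K(1) by (intro measure_mono_fmeasurable fmeasurable_compact) auto
  finally have "measure lborel K > 0" .
  moreover have "measure lborel (cball 0 1 :: 'a set) > 0" by (rule content_cball_pos) simp
  ultimately show ?thesis by (simp add: vrad_def)
qed

section \<open>Invariance of the classes of bodies\<close>

lemma convex_bodies0_SL_image:
  fixes T :: "real^'n \<Rightarrow> real^'n"
  assumes "T \<in> SL" "K \<in> convex_bodies0"
  shows "T ` K \<in> convex_bodies0"
proof -
  note T = SL_D[OF assms(1)]
  have "compact (T ` K)"
    using assms(2) T(1) by (intro compact_linear_image) (auto simp: convex_bodies0_def)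
  then show ?thesis
    using assms(2) T linear_0[OF T(1)]
    by (auto simp: convex_bodies0_def convex_linear_image interior_bijective_linear_image image_iff intro!: bexI[of _ 0])
qed

lemma K_centroid_SL_image:
  fixes T :: "real^'n \<Rightarrow> real^'n"
  assumes "T \<in> SL" "K \<in> K_centroid"
  shows "T ` K \<in> K_centroid"
proof -
  have "compact K" "K \<in> convex_bodies0" "centroid K = 0"
    using assms by (auto simp: K_centroid_def convex_bodies0_def)
  then show ?thesis
    using assms(1) by (simp add: K_centroid_def convex_bodies0_SL_image centroid_SL_image linear_0 SL_D(1))
qed

text \<open>Membership in \<open>K_santalo\<close> is a condition on the polar, which moves by
  \<open>adjoint (inv T)\<close>. That map is in \<open>SL\<close>, so the invariance of
  \<open>K_centroid\<close> applies to it.\<close>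

lemma K_tilde_SL_image:
  fixes T :: "real^'n \<Rightarrow> real^'n"
  assumes "T \<in> SL" "K \<in> K_tilde"
  shows "T ` K \<in> K_tilde"
proof -
  have "T ` K \<in> K_santalo" if "K \<in> K_santalo"
    using that K_centroid_SL_image[OF SL_adjoint(1)[OF SL_inv[OF assms(1)]]]
      convex_bodies0_SL_image[OF assms(1)]
    unfolding K_santalo_def polar_body_SL_image[OF assms(1)] mem_Collect_eq by blast
  then show ?thesis
    using assms(2) K_centroid_SL_image[OF assms(1)] unfolding K_tilde_def by blast
qed

text \<open>The point is continuity. As \<open>radial K\<close> is known to be continuous on the
  sphere only, the new radial function at \<open>u\<close> is written through the normalization of
  \<open>inv T u\<close>, divided by its norm.\<close>

lemma star_bodies_SL_image:
  fixes T :: "real^'n \<Rightarrow> real^'n"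
  assumes "T \<in> SL" "K \<in> star_bodies"
  shows "T ` K \<in> star_bodies"
proof -
  note T = SL_D[OF assms(1)] and T' = SL_D[OF SL_inv[OF assms(1)]]
  have K: "starlike_body K" using assms(2) by (rule starlike_body_star_bodies)
  have TK: "starlike_body (T ` K)" using K T by (simp add: starlike_body_linear_image)
  have cont: "continuous_on (sphere 0 1) (radial K)" using assms by (simp add: star_bodies_def)
  have ne: "inv T u \<noteq> 0" if "norm u = 1" for u
    using that T'(1,3) by (metis inj_eq linear_0 norm_zero zero_neq_one)
  have eq: "radial (T ` K) u = radial K (inv T u /\<^sub>R norm (inv T u)) / norm (inv T u)" if "norm u = 1" for u
  proof -
    have "radial (T ` K) u = radial K (inv T u)"
      using radial_linear_image[OF T(1,3), of K "inv T u"] T by (simp add: surj_f_inv_f)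
    also have "\<dots> = radial K (norm (inv T u) *\<^sub>R (inv T u /\<^sub>R norm (inv T u)))"
      using ne[OF that] by simp
    also have "\<dots> = radial K (inv T u /\<^sub>R norm (inv T u)) / norm (inv T u)"
      using ne[OF that] by (intro radial_scaleR[OF K]) auto
    finally show ?thesis .
  qed
  have lc: "continuous_on A (inv T)" for A
    using T'(1) by (simp add: linear_continuous_on linear_conv_bounded_linear)
  then have "continuous_on (sphere 0 1) (\<lambda>u. radial K (inv T u /\<^sub>R norm (inv T u)) / norm (inv T u))"
    using ne by (intro continuous_intros continuous_on_compose2[OF cont] lc) auto
  then have "continuous_on (sphere 0 1) (radial (T ` K))"
    by (rule continuous_on_eq) (simp add: eq)
  moreover have "\<forall>u\<in>sphere 0 1. 0 < radial (T ` K) u"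
    by (auto intro!: radial_pos[OF TK])
  moreover have "K \<noteq> {}" using assms by (auto simp: star_bodies_def)
  ultimately show ?thesis using TK by (simp add: star_bodies_def starlike_body_def)
qed

lemma S_tilde_SL_image:
  fixes T :: "real^'n \<Rightarrow> real^'n"
  assumes "T \<in> SL" "L \<in> S_tilde"
  shows "T ` L \<in> S_tilde"
  using assms(2) star_bodies_SL_image[OF assms(1)]
    K_tilde_SL_image[OF SL_adjoint(1)[OF SL_inv[OF assms(1)]]]
  unfolding S_tilde_def polar_body_SL_image[OF assms(1)] mem_Collect_eq by blast

text \<open>Using closure under \<open>inv T\<close> as well turns the inclusion into an equality,
  so competitors can be reindexed by \<open>T\<close>.\<close>

lemma SL_image_invariant:
  fixes T :: "real^'n \<Rightarrow> real^'n"
  assumes inv: "\<And>S L. S \<in> SL \<Longrightarrow> L \<in> \<A> \<Longrightarrow> S ` L \<in> \<A>" and T: "T \<in> SL"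
  shows "(`) T ` \<A> = \<A>"
proof
  show "(`) T ` \<A> \<subseteq> \<A>" using inv[OF T] by blast
  show "\<A> \<subseteq> (`) T ` \<A>"
  proof
    fix L assume L: "L \<in> \<A>"
    have "L = T ` (inv T ` L)" using SL_D[OF T] by (simp add: image_f_inv_f)
    with inv[OF SL_inv[OF T] L] show "L \<in> (`) T ` \<A>" by blast
  qed
qed

section \<open>Invariance of the dual mixed volume\<close>

lemma dual_mixed_volume_SL_image:
  fixes T :: "real^'n \<Rightarrow> real^'n"
  assumes T: "T \<in> SL" and K: "starlike_body K" and L: "starlike_body L"
    and \<phi>: "continuous_on {0<..} \<phi>" "\<And>t. t > 0 \<Longrightarrow> 0 < \<phi> t"
  shows "dual_mixed_volume \<phi> (T ` K) (T ` L) = dual_mixed_volume \<phi> K L"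
proof -
  note lin = SL_D[OF T]
  have TK: "starlike_body (T ` K)" and TL: "starlike_body (T ` L)"
    using K L lin by (simp_all add: starlike_body_linear_image)
  define f where "f x = ennreal (\<phi> (radial (T ` L) x / radial (T ` K) x)) *
      ennreal (DIM(real^'n) * max 0 (ln (radial (T ` K) x))) * indicator (- {0}) x" for x
  have "T x = 0 \<longleftrightarrow> x = 0" for x using lin by (metis injD linear_0)
  then have fT: "f (T x) = ennreal (\<phi> (radial L x / radial K x)) *
      ennreal (DIM(real^'n) * max 0 (ln (radial K x))) * indicator (- {0}) x" for x
    using lin by (simp add: f_def radial_linear_image indicator_def)
  \<comment> \<open>\<open>radial\<close> is unspecified at the origin, so measurability goes
    through versions with default 0 there; the indicator hides the change.\<close>
  have [measurable]: "f \<in> borel_measurable borel"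
  proof -
    define rK where "rK x = (if x = 0 then 0 else radial (T ` K) x)" for x
    define rL where "rL x = (if x = 0 then 0 else radial (T ` L) x)" for x
    define \<psi> where "\<psi> t = (if t \<in> {0<..} then \<phi> t else 0)" for t
    have [measurable]: "rK \<in> borel_measurable borel" "rL \<in> borel_measurable borel"
      unfolding rK_def rL_def using TK TL by (auto intro: borel_measurable_radial)
    have [measurable]: "\<psi> \<in> borel_measurable borel"
      unfolding \<psi>_def using \<phi> by (intro borel_measurable_continuous_on_if) auto
    have "f = (\<lambda>x. ennreal (\<psi> (rL x / rK x)) *
        ennreal (DIM(real^'n) * max 0 (ln (rK x))) * indicator (- {0}) x)"
      using radial_pos[OF TK] radial_pos[OF TL]
      by (auto simp: f_def fun_eq_iff \<psi>_def rK_def rL_def)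
    also have "\<dots> \<in> borel_measurable borel" by measurable
    finally show ?thesis .
  qed
  \<comment> \<open>The integrand sees \<open>x\<close> only through the radial functions of the
    images and the indicator, so the change of variables by \<open>T\<close> restores those of
    \<open>K\<close> and \<open>L\<close>.\<close>
  have "(\<integral>\<^sup>+x. f x \<partial>lborel) = (\<integral>\<^sup>+x. f x \<partial>distr lborel borel T)"
    by (simp add: distr_lborel_SL[OF T])
  also have "\<dots> = (\<integral>\<^sup>+x. f (T x) \<partial>lborel)"
    by (rule nn_integral_distr) (use measurable_SL[OF T] in auto)
  finally show ?thesis
    unfolding fT unfolding f_def
    by (simp add: dual_mixed_volume_eq_nn_integral[OF TK TL \<phi>] dual_mixed_volume_eq_nn_integral[OF K L \<phi>])
qed

text \<open>\<open>T\<close> commutes with dilations, and the polar of the image is an image of the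
  polar under a map in \<open>SL\<close>, so the dilation factor is unchanged.\<close>

lemma dual_mixed_volume_vrad_SL_image:
  fixes T :: "real^'n \<Rightarrow> real^'n"
  assumes T: "T \<in> SL" and K: "starlike_body K" and L: "L \<in> K_tilde \<union> S_tilde"
    and \<phi>: "continuous_on {0<..} \<phi>" "\<And>t. t > 0 \<Longrightarrow> 0 < \<phi> t"
  shows "dual_mixed_volume \<phi> (T ` K) ((*\<^sub>R) (vrad (polar_body (T ` L))) ` (T ` L)) =
    dual_mixed_volume \<phi> K ((*\<^sub>R) (vrad (polar_body L)) ` L)"
proof -
  have tilde: "M \<in> convex_bodies0" if "M \<in> K_tilde" for M :: "(real^'n) set"
    using that by (auto simp: K_tilde_def K_centroid_def K_santalo_def)
  have "starlike_body L \<and> polar_body L \<in> convex_bodies0"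
    using L
  proof
    assume "L \<in> K_tilde"
    then have "L \<in> convex_bodies0" by (rule tilde)
    then show ?thesis by (simp add: starlike_body_convex_bodies0 polar_body_convex_bodies0)
  next
    assume "L \<in> S_tilde"
    then show ?thesis by (simp add: S_tilde_def starlike_body_star_bodies tilde)
  qed
  then have "starlike_body ((*\<^sub>R) (vrad (polar_body L)) ` L)"
    by (simp add: starlike_body_scale_image vrad_pos)
  note dual_mixed_volume_SL_image[OF T K this \<phi>]
  moreover have "vrad (polar_body (T ` L)) = vrad (polar_body L)"
    unfolding polar_body_SL_image[OF T]
    by (intro vrad_SL_image SL_adjoint(1) SL_inv T borel_closed closed_polar_body)
  moreover have "T ` (*\<^sub>R) c ` L = (*\<^sub>R) c ` T ` L" for c
    by (simp add: image_image linear_cmul[OF SL_D(1)[OF T]])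
  ultimately show ?thesis by simp
qed

theorem proposition4p1:
  fixes K :: "(real^'n) set" and \<phi> :: "real \<Rightarrow> real" and T :: "real^'n \<Rightarrow> real^'n"
  assumes "K \<in> star_bodies" and "T \<in> SL"
  shows "(\<phi> \<in> Phi_tilde CARD('n) \<longrightarrow>
            Omega_orlicz_inf \<phi> (T ` K) = Omega_orlicz_inf \<phi> K \<and>
            G_orlicz_inf \<phi> (T ` K) = G_orlicz_inf \<phi> K) \<and>
         (\<phi> \<in> Psi_tilde CARD('n) \<longrightarrow>
            Omega_orlicz_sup \<phi> (T ` K) = Omega_orlicz_sup \<phi> K \<and>
            G_orlicz_sup \<phi> (T ` K) = G_orlicz_sup \<phi> K)"
proof -
  define F where "F K L = ereal (DIM(real^'n) *
    dual_mixed_volume \<phi> K ((*\<^sub>R) (vrad (polar_body L)) ` L))" for K L :: "(real^'n) set"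
  \<comment> \<open>The sets of values agree over each class of competitors, which settles infima
    and suprema at once.\<close>
  have img: "F (T ` K) ` \<A> = F K ` \<A>"
    if \<phi>: "\<phi> \<in> Phi_tilde CARD('n) \<or> \<phi> \<in> Psi_tilde CARD('n)"
      and \<A>: "\<A> = K_tilde \<or> \<A> = S_tilde" for \<A>
  proof -
    have cont: "continuous_on {0<..} \<phi>" and pos: "\<And>t. t > 0 \<Longrightarrow> 0 < \<phi> t"
      using \<phi> by (auto simp: Phi_tilde_def Psi_tilde_def)
    have "(`) T ` \<A> = \<A>"
      using \<A> K_tilde_SL_image S_tilde_SL_image SL_image_invariant[OF _ assms(2), of \<A>] by blast
    then have "F (T ` K) ` \<A> = (\<lambda>L. F (T ` K) (T ` L)) ` \<A>"
      by (metis image_image)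
    also have "\<dots> = F K ` \<A>"
    proof (rule image_cong[OF refl])
      fix L assume "L \<in> \<A>"
      with \<A> have "L \<in> K_tilde \<union> S_tilde" by blast
      then show "F (T ` K) (T ` L) = F K L"
        unfolding F_def using starlike_body_star_bodies[OF assms(1)] assms(2) cont pos
        by (subst dual_mixed_volume_vrad_SL_image) auto
    qed
    finally show ?thesis .
  qed
  show ?thesis
    unfolding Omega_orlicz_inf_def G_orlicz_inf_def Omega_orlicz_sup_def G_orlicz_sup_def
      F_def[symmetric]
    by (simp add: img)
qed

end
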